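(* Let $G$ be a finite simple graph whose vertex set can be partitioned into stable blocks $V_1,\dots,V_n$. Then $\sigma(G)=\min_{1\le i\le n}\sigma(G[V_i])$.
   Context: All graphs are finite, undirected and simple; $G[S]$ denotes the induced subgraph on $S$, $\Delta$ maximum degree, $\alpha$ independence number. For a graph $G=(V,E)$ with at least one edge, $\sigma(G)=\min\{\Delta(G[S]): S\subseteq V,\ |S|>\alpha(G)\}$; for an edgeless graph $\sigma=\infty$. For a nonempty proper subset $S\subsetneq V$, the border $\mathrm{bord}(S)$ is the set of vertices of $S$ adjacent in $G$ to at least one vertex of $V\setminus S$, the interior is $\mathrm{int}(S)=S\setminus\mathrm{bord}(S)$, and $S$ is a stable block if $\alpha(G[S])=\alpha(G[\mathrm{int}(S)])$. *)

theory Defs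
  imports
    "Graph_Theory.Digraph_Component"
    "HOL-Library.Extended_Nat"
    "HOL-Library.Disjoint_Sets"
begin

text \<open>
  Finite simple graphs are those satisfying the locale predicate \<^const>\<open>graph\<close>: finite
  symmetric digraphs without loops and parallel arcs, i.e. every undirected edge is a pair of
  opposite arcs. The induced subgraph on \<open>S\<close> is \<open>G \<restriction> S\<close>; it is only used for
  \<open>S \<subseteq> verts G\<close>.
\<close>

definition independent_set :: "('a, 'b) pre_digraph \<Rightarrow> 'a set \<Rightarrow> bool" where
  "independent_set G S \<longleftrightarrow> S \<subseteq> verts G \<and> (\<forall>u\<in>S. \<forall>v\<in>S. \<not> u \<rightarrow>\<^bsub>G\<^esub> v)"

definition independence_number :: "('a, 'b) pre_digraph \<Rightarrow> nat" where
  "independence_number G = Max {card S | S. independent_set G S}"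

text \<open>
  In a symmetric digraph without parallel arcs the number of arcs leaving a vertex is its
  degree as a vertex of the undirected graph. The maximum is unspecified for the graph
  without vertices, which never arises below.
\<close>

definition max_degree :: "('a, 'b) pre_digraph \<Rightarrow> nat" where
  "max_degree G = Max (out_degree G ` verts G)"

definition graph_sigma :: "('a, 'b) pre_digraph \<Rightarrow> enat" where
  "graph_sigma G =
    (if arcs G = {} then \<infinity>
     else enat (Min {max_degree (G \<restriction> S) | S.
                       S \<subseteq> verts G \<and> card S > independence_number G}))"

definition vertex_border :: "('a, 'b) pre_digraph \<Rightarrow> 'a set \<Rightarrow> 'a set" where
  "vertex_border G S = {u \<in> S. \<exists>v \<in> verts G - S. u \<rightarrow>\<^bsub>G\<^esub> v}"

definition vertex_interior :: "('a, 'b) pre_digraph \<Rightarrow> 'a set \<Rightarrow> 'a set" where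
  "vertex_interior G S = S - vertex_border G S"

definition stable_block :: "('a, 'b) pre_digraph \<Rightarrow> 'a set \<Rightarrow> bool" where
  "stable_block G S \<longleftrightarrow> S \<noteq> {} \<and> S \<subset> verts G \<and>
     independence_number (G \<restriction> S) = independence_number (G \<restriction> vertex_interior G S)"

end

theory Submission
  imports Defs
begin

text \<open>
  Since a vertex in the interior of \<open>V\<^sub>i\<close> has no neighbour outside \<open>V\<^sub>i\<close>, maximum independent sets
  of the interiors can be glued together, so stability of the blocks gives
  \<open>\<alpha>(G) = \<Sum>\<^sub>i \<alpha>(G[V\<^sub>i])\<close>. Hence a set with more than \<open>\<alpha>(G)\<close> vertices meets some block \<open>V\<^sub>i\<close> in more
  than \<open>\<alpha>(G[V\<^sub>i])\<close> vertices. Conversely, adding maximum independent sets of the interiors of all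
  other blocks to a set \<open>S \<subseteq> V\<^sub>i\<close> with more than \<open>\<alpha>(G[V\<^sub>i])\<close> vertices yields a set with more than
  \<open>\<alpha>(G)\<close> vertices, and only adds isolated vertices to \<open>G[S]\<close>.
\<close>

section \<open>Induced subgraphs and independent sets\<close>

lemma induce_subgraph_induce_subgraph:
  assumes "S \<subseteq> T"
  shows "(G \<restriction> T) \<restriction> S = G \<restriction> S"
  using assms by (auto simp: induce_subgraph_def)

lemma dominates_induce_subgraph_iff:
  "u \<rightarrow>\<^bsub>G \<restriction> S\<^esub> v \<longleftrightarrow> u \<in> S \<and> v \<in> S \<and> u \<rightarrow>\<^bsub>G\<^esub> v"
  by (auto simp: arcs_ends_conv)

lemma independent_set_induce_subgraph_iff:
  assumes "A \<subseteq> verts G"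
  shows "independent_set (G \<restriction> A) S \<longleftrightarrow> S \<subseteq> A \<and> independent_set G S"
  using assms unfolding independent_set_def dominates_induce_subgraph_iff induce_subgraph_verts
  by blast

lemma independent_set_subset:
  assumes "independent_set G S" "T \<subseteq> S"
  shows "independent_set G T"
  using assms unfolding independent_set_def by blast

lemma finite_card_independent_sets:
  assumes "finite (verts G)"
  shows "finite {card S | S. independent_set G S}"
proof -
  have "{card S | S. independent_set G S} \<subseteq> card ` Pow (verts G)"
    by (auto simp: independent_set_def)
  then show ?thesis
    using assms finite_subset by blast
qed

lemma card_le_independence_number:
  assumes "finite (verts G)" "independent_set G S"
  shows "card S \<le> independence_number G"
  unfolding independence_number_def
  using finite_card_independent_sets[OF assms(1)] assms(2) by (intro Max_ge) auto

lemma obtain_maximum_independent_set: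
  assumes "finite (verts G)"
  obtains S where "independent_set G S" "card S = independence_number G"
proof -
  have "independent_set G {}"
    by (simp add: independent_set_def)
  then have "{card S | S. independent_set G S} \<noteq> {}"
    by blast
  then have "independence_number G \<in> {card S | S. independent_set G S}"
    unfolding independence_number_def
    using finite_card_independent_sets[OF assms] Max_in by blast
  then show thesis
    using that by auto
qed

section \<open>Maximum degrees and \<open>graph_sigma\<close>\<close>

lemma finite_max_degrees:
  assumes "finite (verts G)"
  shows "finite {max_degree (G \<restriction> S) | S. S \<subseteq> verts G \<and> card S > k}"
proof -
  have "{max_degree (G \<restriction> S) | S. S \<subseteq> verts G \<and> card S > k}
      \<subseteq> (\<lambda>S. max_degree (G \<restriction> S)) ` Pow (verts G)"
    by auto
  then show ?thesis
    using assms finite_subset by blast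
qed

context fin_digraph
begin

text \<open>Without arcs every vertex set is independent. A set larger than the independence number
  therefore excludes the \<infinity> case of \<open>graph_sigma\<close>.\<close>

lemma arcs_nonempty_if_card_gt_independence_number:
  assumes "S \<subseteq> verts G" "card S > independence_number G"
  shows "arcs G \<noteq> {}"
proof
  assume "arcs G = {}"
  then have "independent_set G S"
    using assms(1) by (auto simp: independent_set_def arcs_ends_conv)
  then have "card S \<le> independence_number G"
    by (simp add: card_le_independence_number)
  with assms(2) show False
    by simp
qed

lemma graph_sigma_le:
  assumes "S \<subseteq> verts G" "card S > independence_number G"
  shows "graph_sigma G \<le> enat (max_degree (G \<restriction> S))"
proof -
  have "Min {max_degree (G \<restriction> S) | S. S \<subseteq> verts G \<and> card S > independence_number G}
      \<le> max_degree (G \<restriction> S)"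
    using assms finite_max_degrees[OF finite_verts] by (intro Min_le) auto
  then show ?thesis
    using arcs_nonempty_if_card_gt_independence_number[OF assms] by (simp add: graph_sigma_def)
qed

text \<open>Enlarging the vertex set only adds arcs at each old vertex. Nonemptiness of
  \<open>S\<close> keeps the maximum on the left away from its unspecified value.\<close>

lemma max_degree_induce_subgraph_mono:
  assumes "S \<subseteq> T" "T \<subseteq> verts G" "S \<noteq> {}"
  shows "max_degree (G \<restriction> S) \<le> max_degree (G \<restriction> T)"
proof -
  have fin: "finite T" "finite S"
    using assms finite_subset[OF _ finite_verts] by auto
  have "out_degree (G \<restriction> S) u \<le> Max (out_degree (G \<restriction> T) ` T)" if "u \<in> S" for u
  proof -
    have "out_degree (G \<restriction> S) u \<le> out_degree (G \<restriction> T) u"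
      unfolding out_degree_def out_arcs_def
      using \<open>S \<subseteq> T\<close> finite_arcs by (intro card_mono) (auto intro: finite_subset)
    also have "\<dots> \<le> Max (out_degree (G \<restriction> T) ` T)"
      using fin that assms(1) by (intro Max_ge) auto
    finally show ?thesis .
  qed
  then show ?thesis
    using fin assms(3) by (simp add: max_degree_def)
qed

text \<open>The vertices of \<open>T - S\<close> are isolated in \<open>G \<restriction> T\<close>,
  so they contribute only degree 0, and degrees on \<open>S\<close> do not change.\<close>

lemma max_degree_induce_subgraph_le_if_arcs_eq:
  assumes "S \<subseteq> T" "T \<subseteq> verts G" "S \<noteq> {}" "arcs (G \<restriction> T) = arcs (G \<restriction> S)"
  shows "max_degree (G \<restriction> T) \<le> max_degree (G \<restriction> S)"
proof -
  have fin: "finite T" "finite S"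
    using assms finite_subset[OF _ finite_verts] by auto
  have "out_degree (G \<restriction> T) u \<le> Max (out_degree (G \<restriction> S) ` S)" if "u \<in> T" for u
  proof (cases "u \<in> S")
    case True
    have "out_degree (G \<restriction> T) u = out_degree (G \<restriction> S) u"
      unfolding out_degree_def out_arcs_def assms(4) by simp
    then show ?thesis
      using fin True by simp
  next
    case False
    then have "out_arcs (G \<restriction> T) u = {}"
      unfolding out_arcs_def assms(4) by auto
    then show ?thesis
      by (simp add: out_degree_def)
  qed
  moreover have "T \<noteq> {}"
    using assms(1,3) by blast
  ultimately show ?thesis
    using fin by (simp add: max_degree_def)
qed

end

text \<open>The minimum is attained once some set qualifies, and an arc makes \<open>verts G\<close>
  itself such a set.\<close>

lemma (in digraph) obtain_graph_sigma:
  assumes "arcs G \<noteq> {}"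
  obtains S where "S \<subseteq> verts G" "card S > independence_number G"
    "graph_sigma G = enat (max_degree (G \<restriction> S))"
proof -
  let ?D = "{max_degree (G \<restriction> S) | S. S \<subseteq> verts G \<and> card S > independence_number G}"
  obtain I where I: "independent_set G I" "card I = independence_number G"
    using obtain_maximum_independent_set[OF finite_verts] .
  obtain e where "e \<in> arcs G"
    using assms by blast
  then have "tail G e \<rightarrow>\<^bsub>G\<^esub> head G e" "tail G e \<in> verts G" "head G e \<in> verts G"
    by (auto simp: arcs_ends_conv)
  \<comment> \<open>An independent set cannot contain both ends of \<open>e\<close>.\<close>
  then have "I \<subset> verts G"
    using I(1) unfolding independent_set_def by blast
  then have "independence_number G < card (verts G)"
    using I(2) psubset_card_mono[OF finite_verts, of I] by simp
  then have "?D \<noteq> {}"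
    by blast
  then have "Min ?D \<in> ?D"
    using Min_in finite_max_degrees[OF finite_verts] by blast
  then obtain S where "S \<subseteq> verts G" "card S > independence_number G" "Min ?D = max_degree (G \<restriction> S)"
    by blast
  with assms show thesis
    using that by (simp add: graph_sigma_def)
qed

text \<open>Allows the results on \<open>graph_sigma\<close> to be interpreted for the
  blocks.\<close>

lemma (in digraph) digraph_induce_subgraph:
  assumes "S \<subseteq> verts G"
  shows "digraph (G \<restriction> S)"
proof -
  interpret H: wf_digraph "G \<restriction> S" ..
  show ?thesis
    using assms finite_subset[OF _ finite_verts] no_loops no_multi_arcs
    by unfold_locales auto
qed

section \<open>Gluing independent sets of the block interiors\<close>

locale stable_block_partition = graph G for G :: "('a, 'b) pre_digraph" +
  fixes I :: "'i set" and V :: "'i \<Rightarrow> 'a set"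
  assumes finite_index: "finite I"
    and disjoint_blocks: "disjoint_family_on V I"
    and UN_blocks: "(\<Union>i\<in>I. V i) = verts G"
    and stable_blocks: "\<And>i. i \<in> I \<Longrightarrow> stable_block G (V i)"
begin

lemma block_subset: "i \<in> I \<Longrightarrow> V i \<subseteq> verts G"
  using UN_blocks by blast

lemma digraph_block: "i \<in> I \<Longrightarrow> digraph (G \<restriction> V i)"
  by (simp add: block_subset digraph_induce_subgraph)

lemma card_eq_sum_blocks:
  assumes "S \<subseteq> verts G"
  shows "card S = (\<Sum>i\<in>I. card (S \<inter> V i))"
proof -
  have "S = (\<Union>i\<in>I. S \<inter> V i)"
    using assms UN_blocks by auto
  moreover have "card (\<Union>i\<in>I. S \<inter> V i) = (\<Sum>i\<in>I. card (S \<inter> V i))"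
    using finite_index disjoint_blocks finite_subset[OF assms finite_verts]
    by (intro card_UN_disjoint) (auto simp: disjoint_family_on_def)
  ultimately show ?thesis
    by simp
qed

text \<open>One maximum independent set of each interior, fixed by choice. Its size is stated
  through the whole block, which is what stability provides.\<close>

definition interior_set :: "'i \<Rightarrow> 'a set" where
  "interior_set i = (SOME J. independent_set G J \<and> J \<subseteq> vertex_interior G (V i) \<and>
     card J = independence_number (G \<restriction> V i))"

lemma interior_set:
  assumes "i \<in> I"
  shows "independent_set G (interior_set i)"
    and "interior_set i \<subseteq> vertex_interior G (V i)"
    and "card (interior_set i) = independence_number (G \<restriction> V i)"
proof -
  let ?A = "vertex_interior G (V i)"
  have A: "?A \<subseteq> verts G"
    using block_subset[OF assms] by (auto simp: vertex_interior_def)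
  then have "finite (verts (G \<restriction> ?A))"
    using finite_subset[OF _ finite_verts] by simp
  then obtain J where "independent_set (G \<restriction> ?A) J" "card J = independence_number (G \<restriction> ?A)"
    using obtain_maximum_independent_set by blast
  then have "\<exists>J. independent_set G J \<and> J \<subseteq> ?A \<and> card J = independence_number (G \<restriction> V i)"
    using stable_blocks[OF assms] A
    by (auto simp: stable_block_def independent_set_induce_subgraph_iff)
  then show "independent_set G (interior_set i)" "interior_set i \<subseteq> ?A"
    "card (interior_set i) = independence_number (G \<restriction> V i)"
    unfolding interior_set_def by (metis (mono_tags, lifting) someI_ex)+
qed

lemma interior_set_subset: "i \<in> I \<Longrightarrow> interior_set i \<subseteq> V i"
  using interior_set(2) unfolding vertex_interior_def by blast

text \<open>A neighbour outside \<open>V i\<close> would put \<open>u\<close> on the border; a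
  neighbour inside \<open>interior_set i\<close> would contradict independence.\<close>

lemma interior_set_closed:
  assumes "i \<in> I" "u \<in> interior_set i" "u \<rightarrow>\<^bsub>G\<^esub> v"
  shows "v \<in> V i" "v \<notin> interior_set i"
proof -
  show "v \<in> V i"
    using assms interior_set(2)[OF assms(1)] adj_in_verts[OF assms(3)]
    by (auto simp: vertex_interior_def vertex_border_def)
  show "v \<notin> interior_set i"
    using assms interior_set(1)[OF assms(1)] by (auto simp: independent_set_def)
qed

text \<open>Each \<open>interior_set j\<close> stays inside its own block and the blocks are
  disjoint. Together with \<open>card_eq_sum_blocks\<close> this gives the size of a glued
  set.\<close>

lemma UN_interior_sets_inter_block:
  assumes "K \<subseteq> I" "i \<in> I"
  shows "(\<Union>j\<in>K. interior_set j) \<inter> V i = (if i \<in> K then interior_set i else {})"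
proof -
  have "interior_set j \<inter> V i = (if j = i then interior_set i else {})" if "j \<in> K" for j
  proof (cases "j = i")
    case True
    then show ?thesis
      using interior_set_subset[OF assms(2)] by auto
  next
    case False
    then have "V j \<inter> V i = {}"
      using disjoint_blocks that assms unfolding disjoint_family_on_def by blast
    then show ?thesis
      using False interior_set_subset[of j] that assms(1) by auto
  qed
  then have "(\<Union>j\<in>K. interior_set j \<inter> V i) = (if i \<in> K then interior_set i else {})"
    by auto
  then show ?thesis
    by simp
qed

lemma UN_interior_sets_subset:
  assumes "K \<subseteq> I"
  shows "(\<Union>j\<in>K. interior_set j) \<subseteq> verts G"
  using assms interior_set_subset block_subset by blast

text \<open>All neighbours of \<open>u\<close> lie in its own block but outside the chosen set
  there. That block is disjoint from \<open>S\<close>, and the glued set meets it only in the chosen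
  set.\<close>

lemma not_adj_UN_interior_sets:
  assumes "K \<subseteq> I" "S \<inter> (\<Union>j\<in>K. V j) = {}"
    and "u \<in> (\<Union>j\<in>K. interior_set j)" "v \<in> S \<union> (\<Union>j\<in>K. interior_set j)"
  shows "\<not> u \<rightarrow>\<^bsub>G\<^esub> v"
proof
  assume "u \<rightarrow>\<^bsub>G\<^esub> v"
  obtain i where i: "i \<in> K" "u \<in> interior_set i"
    using assms(3) by blast
  then have "i \<in> I"
    using assms(1) by blast
  then have "v \<in> V i" "v \<notin> interior_set i"
    using interior_set_closed i \<open>u \<rightarrow>\<^bsub>G\<^esub> v\<close> by blast+
  then have "v \<notin> (\<Union>j\<in>K. interior_set j)"
    using UN_interior_sets_inter_block[OF assms(1) \<open>i \<in> I\<close>] i(1) by auto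
  moreover have "v \<notin> S"
    using assms(2) i(1) \<open>v \<in> V i\<close> by blast
  ultimately show False
    using assms(4) by blast
qed

lemma independence_number_eq_sum_blocks:
  "independence_number G = (\<Sum>i\<in>I. independence_number (G \<restriction> V i))"
proof (rule antisym)
  obtain S where S: "independent_set G S" "card S = independence_number G"
    using obtain_maximum_independent_set[OF finite_verts] .
  \<comment> \<open>A maximum independent set of \<open>G\<close> leaves an independent trace in
    every block.\<close>
  have "card (S \<inter> V i) \<le> independence_number (G \<restriction> V i)" if "i \<in> I" for i
  proof (rule card_le_independence_number)
    show "finite (verts (G \<restriction> V i))"
      using finite_subset[OF block_subset[OF that] finite_verts] by simp
    show "independent_set (G \<restriction> V i) (S \<inter> V i)"
      using S(1) block_subset[OF that]
      by (auto simp: independent_set_induce_subgraph_iff intro: independent_set_subset)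
  qed
  moreover have "S \<subseteq> verts G"
    using S(1) by (simp add: independent_set_def)
  ultimately show "independence_number G \<le> (\<Sum>i\<in>I. independence_number (G \<restriction> V i))"
    using S(2) card_eq_sum_blocks[of S] by (metis (no_types, lifting) sum_mono)
next
  let ?J = "\<Union>i\<in>I. interior_set i"
  have J: "?J \<subseteq> verts G"
    by (simp add: UN_interior_sets_subset)
  moreover have "\<not> u \<rightarrow>\<^bsub>G\<^esub> v" if "u \<in> ?J" "v \<in> ?J" for u v
    using not_adj_UN_interior_sets[of I "{}"] that by simp
  ultimately have "independent_set G ?J"
    by (simp add: independent_set_def)
  then have "card ?J \<le> independence_number G"
    by (simp add: card_le_independence_number)
  moreover have "card ?J = (\<Sum>i\<in>I. independence_number (G \<restriction> V i))"
    unfolding card_eq_sum_blocks[OF J]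
    by (intro sum.cong) (simp_all add: UN_interior_sets_inter_block interior_set(3))
  ultimately show "(\<Sum>i\<in>I. independence_number (G \<restriction> V i)) \<le> independence_number G"
    by simp
qed

section \<open>Comparing \<open>graph_sigma\<close> of the graph and of its blocks\<close>

lemma graph_sigma_le_block:
  assumes "i \<in> I"
  shows "graph_sigma G \<le> graph_sigma (G \<restriction> V i)"
proof (cases "arcs (G \<restriction> V i) = {}")
  case True
  then show ?thesis
    unfolding graph_sigma_def by simp
next
  case False
  interpret H: digraph "G \<restriction> V i"
    using digraph_block[OF assms] .
  obtain S where S: "S \<subseteq> V i" "card S > independence_number (G \<restriction> V i)"
    "graph_sigma (G \<restriction> V i) = enat (max_degree (G \<restriction> S))"
    using H.obtain_graph_sigma[OF False] by (auto simp: induce_subgraph_induce_subgraph)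
  define J where "J = (\<Union>j\<in>I - {i}. interior_set j)"
  have T: "S \<union> J \<subseteq> verts G"
    using S(1) block_subset[OF assms] UN_interior_sets_subset[of "I - {i}"] by (auto simp: J_def)
  have J_int: "J \<inter> V j = (if j = i then {} else interior_set j)" if "j \<in> I" for j
    using UN_interior_sets_inter_block[of "I - {i}" j] that by (auto simp: J_def)
  have S_int: "S \<inter> V j = (if j = i then S else {})" if "j \<in> I" for j
    using S(1) assms that disjoint_blocks by (auto simp: disjoint_family_on_def)
  \<comment> \<open>The terms agree for \<open>j \<noteq> i\<close>, where \<open>J\<close>
    contributes a maximum independent set; the strict gain comes from \<open>S\<close> at
    \<open>j = i\<close>.\<close>
  have "(\<Sum>j\<in>I. independence_number (G \<restriction> V j)) < (\<Sum>j\<in>I. card ((S \<union> J) \<inter> V j))"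
  proof (rule sum_strict_mono_ex1[OF finite_index])
    show "\<forall>j\<in>I. independence_number (G \<restriction> V j) \<le> card ((S \<union> J) \<inter> V j)"
      using S(2) by (simp add: Int_Un_distrib2 J_int S_int interior_set(3))
    show "\<exists>j\<in>I. independence_number (G \<restriction> V j) < card ((S \<union> J) \<inter> V j)"
      using assms S(2) by (intro bexI[of _ i]) (simp_all add: Int_Un_distrib2 J_int S_int)
  qed
  then have card: "card (S \<union> J) > independence_number G"
    by (simp add: card_eq_sum_blocks[OF T] independence_number_eq_sum_blocks)
  \<comment> \<open>Arcs leaving \<open>J\<close> are excluded by gluing, arcs entering
    \<open>J\<close> then by symmetry. Hence every arc induced on \<open>S \<union> J\<close> has
    both ends in \<open>S\<close>.\<close>
  have not_adj: "\<not> u \<rightarrow>\<^bsub>G\<^esub> v \<and> \<not> v \<rightarrow>\<^bsub>G\<^esub> u" if "u \<in> J" "v \<in> S \<union> J" for u v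
  proof -
    have "S \<inter> (\<Union>j\<in>I - {i}. V j) = {}"
      by (auto simp: Int_UN_distrib S_int)
    then have "\<not> u \<rightarrow>\<^bsub>G\<^esub> v"
      using not_adj_UN_interior_sets[of "I - {i}" S u v] that by (auto simp: J_def)
    then show ?thesis
      using arcs_ends_symmetric[OF sym_arcs] by blast
  qed
  have "arcs (G \<restriction> (S \<union> J)) = arcs (G \<restriction> S)"
  proof -
    have "tail G e \<rightarrow>\<^bsub>G\<^esub> head G e" if "e \<in> arcs G" for e
      using that by (simp add: arcs_ends_conv)
    then show ?thesis
      unfolding induce_subgraph_arcs using not_adj by blast
  qed
  moreover have "S \<noteq> {}"
    using S(2) by auto
  ultimately have "max_degree (G \<restriction> (S \<union> J)) \<le> max_degree (G \<restriction> S)"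
    using T by (intro max_degree_induce_subgraph_le_if_arcs_eq) auto
  then show ?thesis
    using graph_sigma_le[OF T card] S(3) by (metis enat_ord_simps(1) order_trans)
qed

lemma obtain_block_graph_sigma_le:
  assumes "arcs G \<noteq> {}"
  obtains i where "i \<in> I" "graph_sigma (G \<restriction> V i) \<le> graph_sigma G"
proof -
  obtain S where S: "S \<subseteq> verts G" "card S > independence_number G"
    "graph_sigma G = enat (max_degree (G \<restriction> S))"
    using obtain_graph_sigma[OF assms] .
  \<comment> \<open>Pigeonhole: if no block were exceeded, summing over the blocks would give
    \<open>card S \<le> independence_number G\<close>.\<close>
  have "\<exists>i\<in>I. card (S \<inter> V i) > independence_number (G \<restriction> V i)"
    using S(2) sum_mono[of I "\<lambda>i. card (S \<inter> V i)" "\<lambda>i. independence_number (G \<restriction> V i)"]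
    unfolding card_eq_sum_blocks[OF S(1)] independence_number_eq_sum_blocks
    by (meson leD leI)
  then obtain i where i: "i \<in> I" "card (S \<inter> V i) > independence_number (G \<restriction> V i)"
    by blast
  interpret H: digraph "G \<restriction> V i"
    using digraph_block[OF i(1)] .
  have "graph_sigma (G \<restriction> V i) \<le> enat (max_degree (G \<restriction> (S \<inter> V i)))"
    using H.graph_sigma_le[of "S \<inter> V i"] i(2) by (simp add: induce_subgraph_induce_subgraph)
  moreover have "S \<inter> V i \<noteq> {}"
    using i(2) by auto
  then have "max_degree (G \<restriction> (S \<inter> V i)) \<le> max_degree (G \<restriction> S)"
    using S(1) by (intro max_degree_induce_subgraph_mono) auto
  ultimately have "graph_sigma (G \<restriction> V i) \<le> graph_sigma G"
    using S(3) by (metis enat_ord_simps(1) order_trans)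
  with i(1) show thesis
    by (rule that)
qed

lemma graph_sigma_eq_Min_blocks:
  assumes "I \<noteq> {}"
  shows "graph_sigma G = Min ((\<lambda>i. graph_sigma (G \<restriction> V i)) ` I)"
proof (rule antisym)
  show "graph_sigma G \<le> Min ((\<lambda>i. graph_sigma (G \<restriction> V i)) ` I)"
    using assms finite_index graph_sigma_le_block by simp
  show "Min ((\<lambda>i. graph_sigma (G \<restriction> V i)) ` I) \<le> graph_sigma G"
  proof (cases "arcs G = {}")
    \<comment> \<open>Here \<open>graph_sigma G\<close> is \<infinity>, so the bound is
      trivial.\<close>
    case True
    then show ?thesis
      by (simp add: graph_sigma_def)
  next
    case False
    then obtain i where "i \<in> I" "graph_sigma (G \<restriction> V i) \<le> graph_sigma G"
      using obtain_block_graph_sigma_le by blast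
    then show ?thesis
      using finite_index by (meson Min_le finite_imageI imageI order_trans)
  qed
qed

end

theorem theorem4p19:
  fixes G :: "('a, 'b) pre_digraph" and V :: "nat \<Rightarrow> 'a set" and n :: nat
  assumes "graph G"
    and "n \<ge> 1"
    and "disjoint_family_on V {1..n}"
    and "(\<Union>i\<in>{1..n}. V i) = verts G"
    and "\<And>i. i \<in> {1..n} \<Longrightarrow> stable_block G (V i)"
  shows "graph_sigma G = Min ((\<lambda>i. graph_sigma (G \<restriction> V i)) ` {1..n})"
proof -
  interpret graph G
    by fact
  interpret stable_block_partition G "{1..n}" V
    using assms(3-5) by unfold_locales auto
  show ?thesis
    \<comment> \<open>The bound \<open>n \<ge> 1\<close> makes the index set nonempty, so the
      minimum is taken over a nonempty set.\<close>
    using assms(2) by (intro graph_sigma_eq_Min_blocks) auto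
qed

end
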